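(* Let $1\le \ell_1\le k_1$ and $\ell_2\ge 1$ be integers, let $p\in[0,1]$, $q=1-p$, and put $a(p)=q^{\ell_1}p^{\ell_2}$, $\ell=\ell_1+\ell_2$, $m_1=k_1-\ell_1+1$. Let $H^n_{\ell_1,k_1,\ell_2}$ be the number of occurrences, in $n$ independent Bernoulli($p$) trials, of at least $\ell_1$ and at most $k_1$ consecutive 0's followed by at least $\ell_2$ consecutive 1's. Then, for $n\ge\ell$, its probability generating function $\phi_n(t)$ and probability mass function $p_{m,n}$ ($m\ge0$) are given by (i) $\displaystyle \phi_n(t)=\sum_{u=0}^{\lfloor n/\ell\rfloor}\ \sum_{v=0}^{\lfloor (n-u\ell)/(\ell+m_1)\rfloor}\binom{n-u(\ell-1)-v(\ell+m_1-1)}{n-u\ell-v(\ell+m_1),\,u,\,v}(-1)^v q^{v m_1}\,(a(p)(t-1))^{u+v}$; (ii) $\displaystyle p_{m,n}=\sum_{u=0}^{\lfloor n/\ell\rfloor}\ \sum_{v=0}^{\lfloor (n-u\ell)/(\ell+m_1)\rfloor}\binom{n-u(\ell-1)-v(\ell+m_1-1)}{n-u\ell-v(\ell+m_1),\,u,\,v}\binom{u+v}{m}(-1)^{u-m}q^{v m_1}a(p)^{u+v}$.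
   Context: Let $\zeta_1,\zeta_2,\dots$ be independent with $P(\zeta_i=1)=p$ and $P(\zeta_i=0)=q=1-p$. $H^n_{\ell_1,k_1,\ell_2}$ is the number of occurrences of the following pattern within $\zeta_1,\dots,\zeta_n$: a maximal block of consecutive 0's (i.e. one starting at position 1 or immediately preceded by a 1, and ended by a 1) of length $j$ with $\ell_1\le j\le k_1$, immediately followed by at least $\ell_2$ consecutive 1's, where these first $\ell_2$ ones all lie in positions $\le n$. (The pattern is counted as soon as the $\ell_2$-th of these 1's occurs, and once per maximal block of 0's.) For example, for the sequence 00111101100010100011 of length 20, $H^{20}_{1,1,1}=2$, $H^{20}_{1,2,2}=2$, $H^{20}_{2,2,3}=1$, $H^{20}_{1,2,1}=3$. $\phi_n(t)=E\big[t^{H^n_{\ell_1,k_1,\ell_2}}\big]$ and $p_{m,n}=P(H^n_{\ell_1,k_1,\ell_2}=m)$. The multinomial coefficient is $\binom{N}{u_1,\dots,u_s}=\frac{N!}{u_1!\cdots u_s!}$ and $\binom{u+v}{m}=0$ if $m>u+v$. Convention $0^0=1$. *)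

theory Defs
  imports "HOL-Probability.Probability"
begin

(* Trial sequences are functions x on nat; positions are numbered 1, 2, ..., the value x 0 is
   never inspected. *)

definition zero_block :: "(nat \<Rightarrow> nat) \<Rightarrow> nat \<Rightarrow> nat \<Rightarrow> bool" where
  "zero_block x s j \<longleftrightarrow>
     1 \<le> s \<and> 1 \<le> j \<and> (s = 1 \<or> x (s - 1) = 1) \<and> (\<forall>i\<in>{s..<s + j}. x i = 0) \<and> x (s + j) = 1"

(* An occurrence is identified with the pair (start, length) of its maximal block of zeros, so
   every block contributes at most once.  Its first l2 ones occupy the positions
   s + j, ..., s + j + l2 - 1, and the last of these must be \<le> n. *)
definition pattern_count :: "nat \<Rightarrow> nat \<Rightarrow> nat \<Rightarrow> nat \<Rightarrow> (nat \<Rightarrow> nat) \<Rightarrow> nat" where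
  "pattern_count l1 k1 l2 n x =
     card {(s, j). zero_block x s j \<and> l1 \<le> j \<and> j \<le> k1 \<and>
                   (\<forall>i\<in>{s + j..<s + j + l2}. x i = 1) \<and> s + j + l2 \<le> n + 1}"

definition multinomial :: "nat \<Rightarrow> nat list \<Rightarrow> real" where
  "multinomial N us = fact N / (\<Prod>u\<leftarrow>us. fact u)"

end

theory Submission
  imports Defs
begin

text \<open>
  Call the event that the last \<open>l2\<close> of the first \<open>n\<close> trials are ones, preceded by at least \<open>j\<close>
  zeros, \<open>A j n\<close>. An occurrence is completed at \<open>n\<close> exactly on \<open>A l1 n - A (k1 + 1) n\<close>, and on
  \<open>A j n\<close> the number of earlier occurrences is the number within the first \<open>n - l2 - j\<close> trials,
  which is independent of \<open>A j n\<close>. Since \<open>P (A j n) = q^j p^l2\<close>, the generating functions satisfy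
  \<open>\<phi> n = \<phi> (n-1) + a (t-1) \<phi> (n-l) - a (t-1) q^m1 \<phi> (n-l-m1)\<close>, and Pascal's rule for trinomial
  coefficients shows that the claimed sum satisfies the same recurrence. Comparing coefficients
  of \<open>t^m\<close> gives the probability mass function.
\<close>

section \<open>Pathwise recurrence for the count along a fixed 0-1 sequence\<close>

text \<open>This is the event \<open>A j n\<close>. The trial before the \<open>j\<close> zeros is
  left free, which gives "at least \<open>j\<close>" and makes the event depend on the last
  \<open>j + l2\<close> trials only. The first conjunct keeps the natural subtractions from
  truncating.\<close>

definition run_end :: "nat \<Rightarrow> nat \<Rightarrow> nat \<Rightarrow> (nat \<Rightarrow> nat) \<Rightarrow> bool" where
  "run_end l2 j n x \<longleftrightarrow> j + l2 \<le> n \<and> (\<forall>i\<in>{n - l2 - j<..n - l2}. x i = 0) \<and> (\<forall>i\<in>{n - l2<..n}. x i = 1)"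

text \<open>The horizon \<open>n\<close> is left out, so that the counts for different
  \<open>n\<close> become sizes of nested slices of one set.\<close>

definition occurrences :: "nat \<Rightarrow> nat \<Rightarrow> nat \<Rightarrow> (nat \<Rightarrow> nat) \<Rightarrow> (nat \<times> nat) set" where
  "occurrences l1 k1 l2 x = {(s, j). zero_block x s j \<and> l1 \<le> j \<and> j \<le> k1 \<and> (\<forall>i\<in>{s + j..<s + j + l2}. x i = 1)}"

lemma pattern_count_occurrences:
  "pattern_count l1 k1 l2 n x = card {(s, j) \<in> occurrences l1 k1 l2 x. s + j + l2 \<le> n + 1}"
  unfolding pattern_count_def occurrences_def by (rule arg_cong[where f = card]) auto

lemma finite_occurrences: "finite {(s, j) \<in> A. s + j + l2 \<le> n + (1::nat)}"
  by (rule finite_subset[of _ "{..n + 1} \<times> {..n + 1}"]) auto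

text \<open>If two blocks had the same end and different starts, the one preceding the later start
  would lie inside the longer block of zeros. Hence at most one occurrence is completed at each
  time.\<close>

lemma occurrence_unique:
  assumes "(s, j) \<in> occurrences l1 k1 l2 x" "(s', j') \<in> occurrences l1 k1 l2 x" "s + j = s' + j'"
  shows "s = s' \<and> j = j'"
proof -
  have False if "zero_block x s j" "zero_block x s' j'" "s + j = s' + j'" "s < s'" for s j s' j'
  proof -
    have "s' - 1 \<in> {s..<s + j}" "s' \<noteq> 1" using that by (auto simp: zero_block_def)
    thus False using that unfolding zero_block_def by fastforce
  qed
  thus ?thesis using assms unfolding occurrences_def
    by simp (metis add_left_cancel linorder_neqE_nat)
qed

text \<open>The block in front of the final \<open>l2\<close> ones has length at least
  \<open>l1\<close> on the first event and at least \<open>k1 + 1\<close> on the second, so their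
  difference says that its length lies between \<open>l1\<close> and \<open>k1\<close>.\<close>

lemma ex_occurrence_iff:
  assumes x: "\<And>i. 1 \<le> i \<Longrightarrow> x i = 0 \<or> x i = 1" and l: "1 \<le> l1" "l1 \<le> k1" "1 \<le> l2"
  shows "(\<exists>(s, j) \<in> occurrences l1 k1 l2 x. s + j + l2 = n + 1)
     \<longleftrightarrow> run_end l2 l1 n x \<and> \<not> run_end l2 (k1 + 1) n x" (is "?L \<longleftrightarrow> ?R")
proof
  assume ?L
  then obtain s j where o: "(s, j) \<in> occurrences l1 k1 l2 x" and e: "s + j + l2 = n + 1" by auto
  have b: "zero_block x s j" "l1 \<le> j" "j \<le> k1" "\<forall>i\<in>{s + j..<s + j + l2}. x i = 1"
    using o by (auto simp: occurrences_def)
  have "{n - l2 - l1<..n - l2} \<subseteq> {s..<s + j}" "{n - l2<..n} = {s + j..<s + j + l2}"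
    using b e l by (auto simp: zero_block_def)
  moreover have "l1 + l2 \<le> n" using b e by (auto simp: zero_block_def)
  ultimately have "run_end l2 l1 n x" using b unfolding run_end_def zero_block_def by blast
  moreover have "\<not> run_end l2 (k1 + 1) n x"
  proof
    assume r: "run_end l2 (k1 + 1) n x"
    hence s: "s \<noteq> 1" using b e by (auto simp: run_end_def)
    \<comment> \<open>As \<open>j\<close> \<le> \<open>k1\<close>, a run of \<open>k1 + 1\<close>
      zeros would reach past the start of the block and cover the one that precedes it.\<close>
    have "s - 1 \<in> {n - l2 - (k1 + 1)<..n - l2}"
      using r b e s by (auto simp: run_end_def zero_block_def)
    hence "x (s - 1) = 0" using r unfolding run_end_def by blast
    thus False using b s by (auto simp: zero_block_def)
  qed
  ultimately show ?R ..
next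
  assume R: ?R
  \<comment> \<open>\<open>e\<close> is the position of the first of the final \<open>l2\<close>
    ones, so the block sought ends at \<open>e - 1\<close>.\<close>
  define e where "e = n + 1 - l2"
  have n: "l1 + l2 \<le> n" using R by (auto simp: run_end_def)
  define P where "P s \<longleftrightarrow> 1 \<le> s \<and> (\<forall>i\<in>{s..<e}. x i = 0)" for s
  have "{e - l1..<e} = {n - l2 - l1<..n - l2}" "1 \<le> e - l1" using n by (auto simp: e_def)
  hence P: "P (e - l1)" using R unfolding P_def run_end_def by simp
  \<comment> \<open>The leftmost start of a run of zeros reaching up to \<open>e\<close> makes the
    block maximal; its left neighbour is not 0, hence is 1 because \<open>x\<close> is
    binary.\<close>
  define s where "s = (LEAST s. P s)"
  have s: "P s" "s \<le> e - l1" using P by (auto simp: s_def intro: LeastI Least_le)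
  have "1 \<le> s" using s by (simp add: P_def)
  hence sn: "\<not> P (s - 1)" unfolding s_def by (intro not_less_Least) simp
  have "s = 1 \<or> x (s - 1) = 1"
  proof (rule ccontr)
    assume c: "\<not> ?thesis"
    hence "1 < s" using \<open>1 \<le> s\<close> by simp
    moreover have "x (s - 1) = 0" using c x[of "s - 1"] \<open>1 < s\<close> by simp
    moreover have "{s - 1..<e} \<subseteq> insert (s - 1) {s..<e}" by auto
    ultimately have "P (s - 1)" using s unfolding P_def by auto
    thus False using sn by simp
  qed
  moreover have ones: "\<forall>i\<in>{e..<e + l2}. x i = 1" using R n by (auto simp: run_end_def e_def)
  moreover have "x e = 1" using ones l by auto
  moreover have "e - s \<le> k1"
  proof (rule ccontr)
    assume "\<not> ?thesis"
    hence "k1 + 1 + l2 \<le> n" "{n - l2 - (k1 + 1)<..n - l2} \<subseteq> {s..<e}" "{n - l2<..n} = {e..<e + l2}"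
      using n \<open>1 \<le> s\<close> by (auto simp: e_def)
    hence "run_end l2 (k1 + 1) n x" using s ones unfolding run_end_def P_def by blast
    thus False using R by simp
  qed
  moreover have "l1 \<le> e - s" using s n l unfolding e_def by linarith
  ultimately have "(s, e - s) \<in> occurrences l1 k1 l2 x"
    using s l by (auto simp: occurrences_def zero_block_def P_def)
  moreover have "s + (e - s) + l2 = n + 1" using s n l unfolding e_def by linarith
  ultimately show ?L by blast
qed

text \<open>The slice of occurrences completed exactly at \<open>Suc n\<close> has at most one
  element by \<open>occurrence_unique\<close>, and \<open>ex_occurrence_iff\<close> tells when it is
  nonempty.\<close>

lemma pattern_count_Suc:
  assumes "\<And>i. 1 \<le> i \<Longrightarrow> x i = 0 \<or> x i = 1" "1 \<le> l1" "l1 \<le> k1" "1 \<le> l2"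
  shows "pattern_count l1 k1 l2 (Suc n) x = pattern_count l1 k1 l2 n x
     + of_bool (run_end l2 l1 (Suc n) x \<and> \<not> run_end l2 (k1 + 1) (Suc n) x)"
proof -
  let ?O = "occurrences l1 k1 l2 x"
  let ?E = "{(s, j) \<in> ?O. s + j + l2 = Suc n + 1}"
  have "card ?E = of_bool (?E \<noteq> {})"
  proof (cases "?E = {}")
    case False
    then obtain s j where "(s, j) \<in> ?E" by auto
    hence "?E = {(s, j)}" using occurrence_unique[of _ _ l1 k1 l2 x s j] by fastforce
    thus ?thesis by simp
  next
    case True
    show ?thesis unfolding True by simp
  qed
  moreover have "?E \<noteq> {} \<longleftrightarrow> run_end l2 l1 (Suc n) x \<and> \<not> run_end l2 (k1 + 1) (Suc n) x"
  proof -
    have "?E \<noteq> {} \<longleftrightarrow> (\<exists>(s, j) \<in> ?O. s + j + l2 = Suc n + 1)" by auto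
    also have "\<dots> \<longleftrightarrow> run_end l2 l1 (Suc n) x \<and> \<not> run_end l2 (k1 + 1) (Suc n) x"
      by (rule ex_occurrence_iff[OF assms])
    finally show ?thesis .
  qed
  moreover have "{(s, j) \<in> ?O. s + j + l2 \<le> Suc n + 1} = {(s, j) \<in> ?O. s + j + l2 \<le> n + 1} \<union> ?E"
    by auto
  moreover have "card ({(s, j) \<in> ?O. s + j + l2 \<le> n + 1} \<union> ?E)
      = card {(s, j) \<in> ?O. s + j + l2 \<le> n + 1} + card ?E"
    by (rule card_Un_disjoint) (auto intro: finite_occurrences finite_subset[OF _ finite_occurrences[of ?O l2 "Suc n"]])
  ultimately show ?thesis unfolding pattern_count_occurrences by simp
qed

text \<open>An occurrence cannot be completed within the run of zeros, nor before the last of the \<open>l2\<close> ones.\<close>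

lemma pattern_count_run_end:
  assumes "run_end l2 j n x" "1 \<le> j" "1 \<le> l2"
  shows "pattern_count l1 k1 l2 (n - 1) x = pattern_count l1 k1 l2 (n - l2 - j) x"
proof -
  have "s + j' + l2 \<le> n - l2 - j + 1"
    if o: "(s, j') \<in> occurrences l1 k1 l2 x" and le: "s + j' + l2 \<le> n - 1 + 1" for s j'
  proof (rule ccontr)
    assume c: "\<not> ?thesis"
    have z: "x i = 0" if "n - l2 - j < i" "i \<le> n - l2" for i
      using assms that by (auto simp: run_end_def)
    have n: "j + l2 \<le> n" using assms by (auto simp: run_end_def)
    have "1 \<le> s" "1 \<le> j'" using o by (auto simp: occurrences_def zero_block_def)
    \<comment> \<open>A position for the contradiction: the last of the occurrence's
      \<open>l2\<close> ones, or the last zero of the run if that comes first. It would carry both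
      values.\<close>
    define i where "i = min (n - l2) (s + j' + l2 - 1)"
    have "n - l2 - j < i" "i \<le> n - l2"
      using c n assms unfolding i_def by linarith+
    hence "x i = 0" by (rule z)
    moreover have "x i = 1"
    proof -
      have "i \<in> {s + j'..<s + j' + l2}" using c le n assms by (auto simp: i_def)
      thus ?thesis using o by (auto simp: occurrences_def)
    qed
    ultimately show False by simp
  qed
  hence "{(s, j') \<in> occurrences l1 k1 l2 x. s + j' + l2 \<le> n - 1 + 1}
      = {(s, j') \<in> occurrences l1 k1 l2 x. s + j' + l2 \<le> n - l2 - j + 1}"
    using assms by (auto simp: run_end_def)
  thus ?thesis unfolding pattern_count_occurrences by simp
qed

text \<open>One prescribed value per position is the form to which independence and
  \<open>prob_block\<close> apply.\<close>

lemma run_end_iff: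
  "run_end l2 j n x \<longleftrightarrow> j + l2 \<le> n \<and>
     (\<forall>i\<in>{n - l2 - j<..n}. x i = (if i \<le> n - l2 then 0 else 1))"
  unfolding run_end_def by (auto simp: Ball_def)

lemma run_end_mono: "run_end l2 j' n x \<Longrightarrow> j \<le> j' \<Longrightarrow> run_end l2 j n x"
  by (auto simp: run_end_def)

text \<open>A completed occurrence multiplies the power by \<open>t\<close>, that is, adds
  \<open>t - 1\<close> times the old power, which on each run event equals the power at the
  shortened horizon. The longer run implies the shorter one, and then the two terms cancel.\<close>

lemma power_pattern_count_rec:
  fixes t :: real
  assumes "\<And>i. 1 \<le> i \<Longrightarrow> x i = 0 \<or> x i = 1" "1 \<le> l1" "l1 \<le> k1" "1 \<le> l2"
  shows "t ^ pattern_count l1 k1 l2 (Suc n) x = t ^ pattern_count l1 k1 l2 n x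
     + (t - 1) * (t ^ pattern_count l1 k1 l2 (Suc n - l2 - l1) x * of_bool (run_end l2 l1 (Suc n) x)
                - t ^ pattern_count l1 k1 l2 (Suc n - l2 - (k1 + 1)) x * of_bool (run_end l2 (k1 + 1) (Suc n) x))"
  using pattern_count_Suc[OF assms, where n=n] pattern_count_run_end[of l2 l1 "Suc n" x l1 k1]
    pattern_count_run_end[of l2 "k1 + 1" "Suc n" x l1 k1] run_end_mono[of l2 "k1 + 1" "Suc n" x l1] assms
  by (cases "run_end l2 l1 (Suc n) x"; cases "run_end l2 (k1 + 1) (Suc n) x") (auto simp: algebra_simps)

section \<open>The weighted trinomial sum and its recurrence\<close>

text \<open>This is the coefficient of \<open>z^n\<close> in \<open>1 / (1 - z - a z^l - b z^L)\<close>.\<close>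

definition wsum :: "nat \<Rightarrow> nat \<Rightarrow> real \<Rightarrow> real \<Rightarrow> nat \<Rightarrow> real" where
  "wsum l L a b n = (\<Sum>(w, u, v) | w + u * l + v * L = n. multinomial (w + u + v) [w, u, v] * a ^ u * b ^ v)"

text \<open>With \<open>N\<close> and \<open>D\<close> as below, the three terms are
  \<open>w\<close>, \<open>u\<close> and \<open>v\<close> times \<open>fact N / D\<close>. These
  factors vanish exactly in the cases that the conditionals exclude.\<close>

lemma multinomial_pascal:
  assumes "0 < w + u + v"
  shows "multinomial (w + u + v) [w, u, v] =
      (if w = 0 then 0 else multinomial (w - 1 + u + v) [w - 1, u, v])
    + (if u = 0 then 0 else multinomial (w + (u - 1) + v) [w, u - 1, v])
    + (if v = 0 then 0 else multinomial (w + u + (v - 1)) [w, u, v - 1])"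
proof -
  define N where "N = w + u + v - 1"
  define D where "D = (fact w * fact u * fact v :: real)"
  have f: "fact k = (if k = 0 then 1 else real k * fact (k - 1))" for k by (simp add: fact_reduce)
  have 1: "(if w = 0 then 0 else multinomial (w - 1 + u + v) [w - 1, u, v]) = real w * fact N / D"
    by (cases w) (simp_all add: multinomial_def N_def D_def divide_simps del: of_nat_Suc)
  have 2: "(if u = 0 then 0 else multinomial (w + (u - 1) + v) [w, u - 1, v]) = real u * fact N / D"
    by (cases u) (simp_all add: multinomial_def N_def D_def divide_simps del: of_nat_Suc)
  have 3: "(if v = 0 then 0 else multinomial (w + u + (v - 1)) [w, u, v - 1]) = real v * fact N / D"
    by (cases v) (simp_all add: multinomial_def N_def D_def divide_simps del: of_nat_Suc)
  have "multinomial (w + u + v) [w, u, v] = (real w + real u + real v) * fact N / D"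
    using assms f[of "w + u + v"] by (simp add: multinomial_def N_def D_def)
  thus ?thesis unfolding 1 2 3 by (simp add: ring_distribs add_divide_distrib)
qed

lemma finite_weighted_triples:
  assumes "1 \<le> l" "1 \<le> L"
  shows "finite {(w, u, v). w + u * l + v * L = (n::nat)}"
proof (rule finite_subset[of _ "{..n} \<times> {..n} \<times> {..n}"])
  have "w \<le> n \<and> u \<le> n \<and> v \<le> n" if "w + u * l + v * L = n" for w u v
  proof -
    have "u \<le> u * l" "v \<le> v * L" using assms by auto
    thus ?thesis using that by linarith
  qed
  thus "{(w, u, v). w + u * l + v * L = n} \<subseteq> {..n} \<times> {..n} \<times> {..n}"
    by auto
qed simp

lemma wsum_0: assumes "1 \<le> l" "1 \<le> L" shows "wsum l L a b 0 = 1"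
proof -
  have "{(w, u, v). w + u * l + v * L = 0} = {(0, 0, 0)}" using assms by auto
  thus ?thesis by (simp add: wsum_def multinomial_def)
qed

text \<open>Pascal's rule splits every summand in three; lowering \<open>w\<close>, \<open>u\<close>
  or \<open>v\<close> by one then turns the parts into sums of total weight smaller by 1,
  \<open>l\<close> or \<open>L\<close>. The conditionals guard against truncated
  subtraction.\<close>

lemma wsum_rec:
  assumes l: "1 \<le> l" "1 \<le> L"
  shows "wsum l L a b (Suc n) = wsum l L a b n
    + (if l \<le> Suc n then a * wsum l L a b (Suc n - l) else 0)
    + (if L \<le> Suc n then b * wsum l L a b (Suc n - L) else 0)"
proof -
  let ?S = "\<lambda>n. {(w, u, v). w + u * l + v * L = n}"
  let ?f = "\<lambda>w u v. multinomial (w + u + v) [w, u, v] * a ^ u * b ^ v"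
  note fin = finite_weighted_triples[OF l]
  have "wsum l L a b (Suc n) = (\<Sum>(w, u, v) \<in> ?S (Suc n).
      (if w = 0 then 0 else ?f (w - 1) u v)
    + (if u = 0 then 0 else a * ?f w (u - 1) v)
    + (if v = 0 then 0 else b * ?f w u (v - 1)))"
    unfolding wsum_def
  proof (rule sum.cong[OF refl], clarify)
    fix w u v assume "w + u * l + v * L = Suc n"
    hence "0 < w + u + v" by (auto intro!: Nat.gr0I)
    show "?f w u v = (if w = 0 then 0 else ?f (w - 1) u v)
       + (if u = 0 then 0 else a * ?f w (u - 1) v) + (if v = 0 then 0 else b * ?f w u (v - 1))"
      unfolding multinomial_pascal[OF \<open>0 < w + u + v\<close>]
      by (cases u; cases v; cases w) (simp_all add: algebra_simps)
  qed
  also have "\<dots> = (\<Sum>(w, u, v) \<in> ?S (Suc n). if w = 0 then 0 else ?f (w - 1) u v)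
     + (\<Sum>(w, u, v) \<in> ?S (Suc n). if u = 0 then 0 else a * ?f w (u - 1) v)
     + (\<Sum>(w, u, v) \<in> ?S (Suc n). if v = 0 then 0 else b * ?f w u (v - 1))"
    unfolding sum.distrib[symmetric] by (rule sum.cong) auto
  also have "(\<Sum>(w, u, v) \<in> ?S (Suc n). if w = 0 then 0 else ?f (w - 1) u v)
      = (\<Sum>(w, u, v) \<in> {(w, u, v) \<in> ?S (Suc n). w \<noteq> 0}. ?f (w - 1) u v)"
    by (rule sum.mono_neutral_cong_right) (auto intro: fin split: if_splits)
  also have "\<dots> = wsum l L a b n"
    unfolding wsum_def
    by (rule sum.reindex_bij_witness[where i = "\<lambda>(w, u, v). (Suc w, u, v)" and j = "\<lambda>(w, u, v). (w - 1, u, v)"])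
      auto
  also have "(\<Sum>(w, u, v) \<in> ?S (Suc n). if u = 0 then 0 else a * ?f w (u - 1) v)
      = (\<Sum>(w, u, v) \<in> {(w, u, v) \<in> ?S (Suc n). u \<noteq> 0}. a * ?f w (u - 1) v)"
    by (rule sum.mono_neutral_cong_right) (auto intro: fin split: if_splits)
  also have "\<dots> = (if l \<le> Suc n then a * wsum l L a b (Suc n - l) else 0)"
  proof (cases "l \<le> Suc n")
    case True
    have shift: "w + (u - 1) * l + v * L = Suc n - l" if "w + u * l + v * L = Suc n" "u \<noteq> 0" for w u v
      using that by (cases u) auto
    show ?thesis unfolding wsum_def sum_distrib_left if_P[OF True]
      by (rule sum.reindex_bij_witness[where i = "\<lambda>(w, u, v). (w, Suc u, v)" and j = "\<lambda>(w, u, v). (w, u - 1, v)"])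
       (use True in \<open>auto simp: shift[simplified]\<close>)
  next
    case False
    have "u = 0" if "w + u * l + v * L = Suc n" for w u v using that False by (cases u) auto
    thus ?thesis using False by (auto intro!: sum.neutral)
  qed
  also have "(\<Sum>(w, u, v) \<in> ?S (Suc n). if v = 0 then 0 else b * ?f w u (v - 1))
      = (\<Sum>(w, u, v) \<in> {(w, u, v) \<in> ?S (Suc n). v \<noteq> 0}. b * ?f w u (v - 1))"
    by (rule sum.mono_neutral_cong_right) (auto intro: fin split: if_splits)
  also have "\<dots> = (if L \<le> Suc n then b * wsum l L a b (Suc n - L) else 0)"
  proof (cases "L \<le> Suc n")
    case True
    have shift: "w + u * l + (v - 1) * L = Suc n - L" if "w + u * l + v * L = Suc n" "v \<noteq> 0" for w u v
      using that by (cases v) auto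
    show ?thesis unfolding wsum_def sum_distrib_left if_P[OF True]
      by (rule sum.reindex_bij_witness[where i = "\<lambda>(w, u, v). (w, u, Suc v)" and j = "\<lambda>(w, u, v). (w, u, v - 1)"])
       (use True in \<open>auto simp: shift[simplified]\<close>)
  next
    case False
    have "v = 0" if "w + u * l + v * L = Suc n" for w u v using that False by (cases v) auto
    thus ?thesis using False by (auto intro!: sum.neutral)
  qed
  finally show ?thesis .
qed

text \<open>The weight equation determines \<open>w\<close> as \<open>n - u * l - v * L\<close>. The
  two quotients bound \<open>u\<close> and \<open>v\<close> exactly by
  \<open>u * l + v * L \<le> n\<close>, and under this bound no subtraction truncates.\<close>

lemma wsum_nested:
  assumes l: "1 \<le> l" "1 \<le> L"
  shows "wsum l L a b n = (\<Sum>u = 0..n div l. \<Sum>v = 0..(n - u * l) div L.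
     multinomial (n - u * (l - 1) - v * (L - 1)) [n - u * l - v * L, u, v] * a ^ u * b ^ v)"
proof -
  have iff: "u \<le> n div l \<and> v \<le> (n - u * l) div L \<longleftrightarrow> u * l + v * L \<le> n" for u v
  proof -
    have "u \<le> n div l \<longleftrightarrow> u * l \<le> n" "v \<le> (n - u * l) div L \<longleftrightarrow> v * L \<le> n - u * l"
      using l by (simp_all add: less_eq_div_iff_mult_less_eq)
    thus ?thesis by linarith
  qed
  have eq: "n - u * (l - 1) - v * (L - 1) = n - u * l - v * L + u + v" if "u * l + v * L \<le> n" for u v
  proof -
    have "u * l = u * (l - 1) + u" "v * L = v * (L - 1) + v" using l by (auto simp: algebra_simps)
    thus ?thesis using that by linarith
  qed
  have "wsum l L a b n = (\<Sum>(u, v) | u * l + v * L \<le> n.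
     multinomial (n - u * l - v * L + u + v) [n - u * l - v * L, u, v] * a ^ u * b ^ v)"
    unfolding wsum_def
    by (rule sum.reindex_bij_witness[where i = "\<lambda>(u, v). (n - u * l - v * L, u, v)" and j = "\<lambda>(w, u, v). (u, v)"])
      auto
  also have "{(u, v). u * l + v * L \<le> n} = (SIGMA u:{0..n div l}. {0..(n - u * l) div L})"
    by (rule set_eqI) (simp only: split_paired_all mem_Collect_eq split_conv mem_Sigma_iff
      atLeastAtMost_iff le0 simp_thms iff)
  also have "(\<Sum>(u, v)\<in>\<dots>. multinomial (n - u * l - v * L + u + v) [n - u * l - v * L, u, v] * a ^ u * b ^ v)
   = (\<Sum>u = 0..n div l. \<Sum>v = 0..(n - u * l) div L.
     multinomial (n - u * l - v * L + u + v) [n - u * l - v * L, u, v] * a ^ u * b ^ v)"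
    by (rule sum.Sigma[symmetric]) auto
  also have "\<dots> = (\<Sum>u = 0..n div l. \<Sum>v = 0..(n - u * l) div L.
     multinomial (n - u * (l - 1) - v * (L - 1)) [n - u * l - v * L, u, v] * a ^ u * b ^ v)"
  proof (intro sum.cong refl)
    fix u v assume "u \<in> {0..n div l}" "v \<in> {0..(n - u * l) div L}"
    hence "u * l + v * L \<le> n" using iff[of u v] by simp
    thus "multinomial (n - u * l - v * L + u + v) [n - u * l - v * L, u, v] * a ^ u * b ^ v
      = multinomial (n - u * (l - 1) - v * (L - 1)) [n - u * l - v * L, u, v] * a ^ u * b ^ v"
      by (simp only: eq)
  qed
  finally show ?thesis .
qed

section \<open>Measurability, locality and boundedness of the count\<close>

text \<open>Measurability is assumed for the indices 1 to \<open>n\<close> only, so that the lemma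
  serves both the trials and the coordinates of a finite product space.\<close>

lemma measurable_pattern_count:
  assumes X: "\<And>i. 1 \<le> i \<Longrightarrow> i \<le> n \<Longrightarrow> X i \<in> M \<rightarrow>\<^sub>M count_space UNIV" and l: "1 \<le> l2"
  shows "(\<lambda>\<omega>. pattern_count l1 k1 l2 n (\<lambda>i. X i \<omega>)) \<in> M \<rightarrow>\<^sub>M count_space UNIV"
proof -
  define S where "S \<omega> = {(s, j). zero_block (\<lambda>i. X i \<omega>) s j \<and> l1 \<le> j \<and> j \<le> k1 \<and>
     (\<forall>i\<in>{s + j..<s + j + l2}. X i \<omega> = 1) \<and> s + j + l2 \<le> n + 1}" for \<omega>
  have X_eq [measurable]: "Measurable.pred M (\<lambda>\<omega>. X i \<omega> = c)" if "1 \<le> i" "i \<le> n" for i c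
    using X[OF that] by measurable
  have S_meas: "{\<omega> \<in> space M. (s, j) \<in> S \<omega>} \<in> sets M" for s j
  proof (cases "1 \<le> s \<and> 1 \<le> j \<and> s + j + l2 \<le> n + 1")
    \<comment> \<open>Here every inspected position lies between 1 and \<open>n\<close>; for
      \<open>s + j\<close> this uses \<open>1 \<le> l2\<close>.\<close>
    case True
    have "Measurable.pred M (\<lambda>\<omega>. s = 1 \<or> X (s - 1) \<omega> = 1)"
    proof (cases "s = 1")
      case False
      hence "1 \<le> s - 1" "s - 1 \<le> n" using True by auto
      thus ?thesis by measurable
    qed simp
    moreover have "Measurable.pred M (\<lambda>\<omega>. \<forall>i\<in>{s..<s + j}. X i \<omega> = 0)"
      "Measurable.pred M (\<lambda>\<omega>. \<forall>i\<in>{s + j..<s + j + l2}. X i \<omega> = 1)"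
      using True l by (auto intro!: pred_intros_finite X_eq)
    moreover have "Measurable.pred M (\<lambda>\<omega>. X (s + j) \<omega> = 1)"
      using True l by (intro X_eq) auto
    ultimately show ?thesis unfolding S_def mem_Collect_eq split_conv zero_block_def by measurable
  next
    case False
    hence "(s, j) \<notin> S \<omega>" for \<omega> unfolding S_def zero_block_def by blast
    thus ?thesis by simp
  qed
  \<comment> \<open>Pairs are encoded because measurable_card is available for sets of naturals only.\<close>
  have "{\<omega> \<in> space M. i \<in> prod_encode ` S \<omega>} \<in> sets M" for i
  proof -
    obtain s j where "prod_decode i = (s, j)" by fastforce
    hence i: "i = prod_encode (s, j)" by (metis prod_decode_inverse)
    show ?thesis unfolding i inj_image_mem_iff[OF inj_prod_encode] by (rule S_meas)
  qed
  hence "(\<lambda>\<omega>. card (prod_encode ` S \<omega>)) \<in> M \<rightarrow>\<^sub>M count_space UNIV" by (rule measurable_card)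
  moreover have "card (prod_encode ` S \<omega>) = card (S \<omega>)" for \<omega>
    by (rule card_image[OF inj_prod_encode])
  ultimately show ?thesis unfolding pattern_count_def S_def by simp
qed

text \<open>Even the one that closes a counted block lies within the horizon, since
  \<open>1 \<le> l2\<close>. The count is thus a function of the first \<open>n\<close> trials, as
  the independence argument requires.\<close>

lemma pattern_count_cong:
  assumes "\<And>i. 1 \<le> i \<Longrightarrow> i \<le> n \<Longrightarrow> x i = y i" "1 \<le> l2"
  shows "pattern_count l1 k1 l2 n x = pattern_count l1 k1 l2 n y"
proof -
  have "zero_block x s j \<longleftrightarrow> zero_block y s j" if "s + j + l2 \<le> n + 1" for s j
  proof -
    have "x i = y i" if "1 \<le> i" "i \<le> s + j" for i using that \<open>s + j + l2 \<le> n + 1\<close> assms by simp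
    hence "x (s + j) = y (s + j)" "\<forall>i\<in>{s..<s + j}. x i = y i" "s \<noteq> 1 \<longrightarrow> x (s - 1) = y (s - 1)"
      if "1 \<le> s" using that by simp_all
    thus ?thesis unfolding zero_block_def by (cases "1 \<le> s") auto
  qed
  moreover have "(\<forall>i\<in>{s + j..<s + j + l2}. x i = 1) \<longleftrightarrow> (\<forall>i\<in>{s + j..<s + j + l2}. y i = 1)"
    if "s + j + l2 \<le> n + 1" "1 \<le> s" for s j
    using that assms by (intro ball_cong) auto
  moreover have "1 \<le> s" if "zero_block z s j" for z s j using that by (simp add: zero_block_def)
  ultimately have "zero_block x s j \<and> l1 \<le> j \<and> j \<le> k1 \<and>
        (\<forall>i\<in>{s + j..<s + j + l2}. x i = 1) \<and> s + j + l2 \<le> n + 1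
      \<longleftrightarrow> zero_block y s j \<and> l1 \<le> j \<and> j \<le> k1 \<and>
        (\<forall>i\<in>{s + j..<s + j + l2}. y i = 1) \<and> s + j + l2 \<le> n + 1" for s j
    by metis
  thus ?thesis unfolding pattern_count_def by (simp only:)
qed

text \<open>Any bound uniform in \<open>x\<close> would do: it makes the generating function a
  polynomial in \<open>t\<close>.\<close>

lemma pattern_count_le: "pattern_count l1 k1 l2 n x \<le> (n + 2) * (n + 2)"
proof -
  have "pattern_count l1 k1 l2 n x \<le> card ({..n + 1} \<times> {..n + 1})"
    unfolding pattern_count_def by (intro card_mono) auto
  thus ?thesis by simp
qed

lemma (in prob_space) integrable_of_bool:
  "Measurable.pred M P \<Longrightarrow> integrable M (\<lambda>\<omega>. of_bool (P \<omega>) :: real)"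
  by (rule integrable_const_bound[of _ 1]) auto

lemma (in prob_space) expectation_of_bool:
  assumes "Measurable.pred M P"
  shows "expectation (\<lambda>\<omega>. of_bool (P \<omega>)) = prob {\<omega> \<in> space M. P \<omega>}"
proof -
  have "expectation (\<lambda>\<omega>. of_bool (P \<omega>)) = expectation (indicat_real {\<omega> \<in> space M. P \<omega>})"
    by (rule Bochner_Integration.integral_cong) (auto simp: indicator_def)
  thus ?thesis using assms by simp
qed

section \<open>Bernoulli trials\<close>

locale bernoulli_trials = prob_space +
  fixes \<zeta> :: "nat \<Rightarrow> 'a \<Rightarrow> nat" and p q :: real
  assumes indep: "indep_vars (\<lambda>_. count_space UNIV) \<zeta> {1..}"
    and prob_1: "\<And>i. 1 \<le> i \<Longrightarrow> prob {\<omega> \<in> space M. \<zeta> i \<omega> = 1} = p"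
    and prob_0: "\<And>i. 1 \<le> i \<Longrightarrow> prob {\<omega> \<in> space M. \<zeta> i \<omega> = 0} = q"
    and p_plus_q: "p + q = 1"
begin

lemma measurable_trial: "1 \<le> i \<Longrightarrow> \<zeta> i \<in> M \<rightarrow>\<^sub>M count_space UNIV"
  using indep by (auto simp: indep_vars_def)

text \<open>The trials are \<open>nat\<close>-valued, but the disjoint events "0" and "1" have total
  probability \<open>q + p = 1\<close>; countably many null sets are discarded.\<close>

lemma AE_binary: "AE \<omega> in M. \<forall>i\<ge>1. \<zeta> i \<omega> = 0 \<or> \<zeta> i \<omega> = 1"
  unfolding AE_all_countable
proof
  fix i :: nat
  show "AE \<omega> in M. 1 \<le> i \<longrightarrow> \<zeta> i \<omega> = 0 \<or> \<zeta> i \<omega> = 1"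
  proof (cases "1 \<le> i")
    case True
    note [measurable] = measurable_trial[OF True]
    have "prob ({\<omega> \<in> space M. \<zeta> i \<omega> = 0} \<union> {\<omega> \<in> space M. \<zeta> i \<omega> = 1}) = q + p"
      unfolding prob_0[OF True, symmetric] prob_1[OF True, symmetric]
      by (rule finite_measure_Union) auto
    hence "AE \<omega> in M. \<omega> \<in> {\<omega> \<in> space M. \<zeta> i \<omega> = 0} \<union> {\<omega> \<in> space M. \<zeta> i \<omega> = 1}"
      using p_plus_q by (intro AE_prob_1) simp
    thus ?thesis by (rule AE_mp) auto
  qed simp
qed

lemma prob_block:
  assumes "finite J" "J \<subseteq> {1..}" "\<And>i. i \<in> J \<Longrightarrow> c i = 0 \<or> c i = 1"
  shows "prob {\<omega> \<in> space M. \<forall>i\<in>J. \<zeta> i \<omega> = c i} = (\<Prod>i\<in>J. if c i = 0 then q else p)"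
\<comment> \<open>The product rule for independent variables asks for a nonempty index set.\<close>
proof (cases "J = {}")
  case False
  have "prob (\<Inter>i\<in>J. \<zeta> i -` {c i} \<inter> space M) = (\<Prod>i\<in>J. prob (\<zeta> i -` {c i} \<inter> space M))"
    using False assms by (intro indep_varsD[OF indep]) auto
  also have "(\<Inter>i\<in>J. \<zeta> i -` {c i} \<inter> space M) = {\<omega> \<in> space M. \<forall>i\<in>J. \<zeta> i \<omega> = c i}"
    using False by auto
  also have "(\<Prod>i\<in>J. prob (\<zeta> i -` {c i} \<inter> space M)) = (\<Prod>i\<in>J. if c i = 0 then q else p)"
  proof (rule prod.cong[OF refl])
    fix i assume i: "i \<in> J"
    have "\<zeta> i -` {c i} \<inter> space M = {\<omega> \<in> space M. \<zeta> i \<omega> = c i}" by auto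
    thus "prob (\<zeta> i -` {c i} \<inter> space M) = (if c i = 0 then q else p)"
      using assms i prob_0[of i] prob_1[of i] by fastforce
  qed
  finally show ?thesis .
qed (simp add: prob_space)

section \<open>The generating function of the count and its recurrence\<close>

context
  fixes l1 k1 l2 :: nat
  assumes bounds: "1 \<le> l1" "l1 \<le> k1" "1 \<le> l2"
begin

definition H :: "nat \<Rightarrow> 'a \<Rightarrow> nat" where
  "H n \<omega> = pattern_count l1 k1 l2 n (\<lambda>i. \<zeta> i \<omega>)"

lemma measurable_H [measurable]: "H n \<in> M \<rightarrow>\<^sub>M count_space UNIV"
  unfolding H_def[abs_def] using bounds by (intro measurable_pattern_count measurable_trial)

text \<open>The degree bound \<open>B\<close> stays free, so that it can later be raised to include
  any prescribed coefficient.\<close>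

lemma power_H_expand:
  fixes t :: real
  assumes "(n + 2) * (n + 2) \<le> B"
  shows "t ^ H n \<omega> = (\<Sum>m\<le>B. of_bool (H n \<omega> = m) * t ^ m)"
proof -
  have "H n \<omega> \<le> B" using assms pattern_count_le order_trans unfolding H_def by blast
  hence "(\<Sum>m\<in>{..B}. of_bool (H n \<omega> = m) * t ^ m) = (\<Sum>m\<in>{H n \<omega>}. of_bool (H n \<omega> = m) * t ^ m)"
    by (intro sum.mono_neutral_right) auto
  thus ?thesis by simp
qed

lemma integrable_power_H: "integrable M (\<lambda>\<omega>. t ^ H n \<omega> :: real)"
  unfolding power_H_expand[OF order_refl]
  by (intro Bochner_Integration.integrable_sum integrable_mult_left integrable_of_bool) measurable

lemma expectation_power_H:
  fixes t :: real
  assumes "(n + 2) * (n + 2) \<le> B"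
  shows "expectation (\<lambda>\<omega>. t ^ H n \<omega>) = (\<Sum>m\<le>B. prob {\<omega> \<in> space M. H n \<omega> = m} * t ^ m)"
  unfolding power_H_expand[OF assms]
  by (subst Bochner_Integration.integral_sum)
    (auto simp: expectation_of_bool intro!: integrable_mult_left integrable_of_bool)

definition pgf :: "real \<Rightarrow> nat \<Rightarrow> real" where
  "pgf t n = expectation (\<lambda>\<omega>. t ^ H n \<omega>)"

lemma measurable_run_end [measurable]: "Measurable.pred M (\<lambda>\<omega>. run_end l2 j n (\<lambda>i. \<zeta> i \<omega>))"
proof -
  have "Measurable.pred M (\<lambda>\<omega>. \<zeta> i \<omega> = c)" if "1 \<le> i" for i c
    using measurable_trial[OF that] by measurable
  thus ?thesis unfolding run_end_iff
    by (intro pred_intros_logic pred_intros_finite) auto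
qed

lemma integrable_power_H_run_end:
  "integrable M (\<lambda>\<omega>. t ^ H m \<omega> * of_bool (run_end l2 j n (\<lambda>i. \<zeta> i \<omega>)) :: real)"
  by (rule Bochner_Integration.integrable_bound[OF integrable_power_H[of t m]]) auto

text \<open>With \<open>N = n - l2 - j\<close>, the count \<open>H N\<close> depends on the trials
  up to \<open>N\<close> and the run on the trials after \<open>N\<close>. Independence factors the
  expectation, and the run has probability \<open>q ^ j * p ^ l2\<close>.\<close>

lemma expectation_power_H_run_end:
  fixes t :: real
  shows "expectation (\<lambda>\<omega>. t ^ H (n - l2 - j) \<omega> * of_bool (run_end l2 j n (\<lambda>i. \<zeta> i \<omega>)))
    = (if j + l2 \<le> n then q ^ j * p ^ l2 * pgf t (n - l2 - j) else 0)"
proof (cases "j + l2 \<le> n")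
  case False
  thus ?thesis by (simp add: run_end_def)
next
  case True
  define N where "N = n - l2 - j"
  define J where "J = {N<..n}"
  define c :: "nat \<Rightarrow> nat" where "c i = (if i \<le> n - l2 then 0 else 1)" for i
  let ?P = "\<lambda>A. PiM A (\<lambda>_. count_space UNIV :: nat measure)"
  \<comment> \<open>\<open>F\<close> and \<open>G\<close> express the two factors as functions of
    restricted sequences, because independence is available for restrictions to disjoint index
    sets.\<close>
  define F where "F x = t ^ pattern_count l1 k1 l2 N x" for x
  define G where "G x = (of_bool (\<forall>i\<in>J. x i = c i) :: real)" for x :: "nat \<Rightarrow> nat"
  have "(\<lambda>x. pattern_count l1 k1 l2 N (\<lambda>i. x i)) \<in> ?P {1..N} \<rightarrow>\<^sub>M count_space UNIV"
    using bounds by (intro measurable_pattern_count measurable_component_singleton) auto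
  hence F: "F \<in> borel_measurable (?P {1..N})"
    unfolding F_def[abs_def] by measurable
  have "Measurable.pred (?P J) (\<lambda>x. x i = c i)" if "i \<in> J" for i
    using measurable_component_singleton[OF that, of "\<lambda>_. count_space UNIV :: nat measure"] by measurable
  hence "Measurable.pred (?P J) (\<lambda>x. \<forall>i\<in>J. x i = c i)"
    by (intro pred_intros_finite) (auto simp: J_def)
  hence G: "G \<in> borel_measurable (?P J)" unfolding G_def[abs_def] by measurable
  let ?r = "\<lambda>A \<omega>. restrict (\<lambda>i. \<zeta> i \<omega>) A"
  have "indep_var borel (F \<circ> ?r {1..N}) borel (G \<circ> ?r J)"
    by (intro indep_var_compose[OF indep_var_restrict[OF indep]] F G) (auto simp: J_def)
  moreover have Feq: "F \<circ> ?r {1..N} = (\<lambda>\<omega>. t ^ H N \<omega>)"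
    unfolding F_def[abs_def] H_def comp_def using bounds
    by (intro ext arg_cong2[where f = power] refl pattern_count_cong) auto
  moreover have Geq: "G \<circ> ?r J = (\<lambda>\<omega>. of_bool (run_end l2 j n (\<lambda>i. \<zeta> i \<omega>)))"
    using True by (auto simp: G_def run_end_iff c_def J_def N_def fun_eq_iff)
  ultimately have "expectation (\<lambda>\<omega>. t ^ H N \<omega> * of_bool (run_end l2 j n (\<lambda>i. \<zeta> i \<omega>)))
    = pgf t N * expectation (\<lambda>\<omega>. of_bool (run_end l2 j n (\<lambda>i. \<zeta> i \<omega>)))"
    unfolding pgf_def
    by (intro indep_var_lebesgue_integral integrable_power_H integrable_of_bool measurable_run_end) simp
  also have "expectation (\<lambda>\<omega>. of_bool (run_end l2 j n (\<lambda>i. \<zeta> i \<omega>)))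
      = prob {\<omega> \<in> space M. \<forall>i\<in>J. \<zeta> i \<omega> = c i}"
    unfolding expectation_of_bool[OF measurable_run_end] using True
    by (simp add: run_end_iff J_def N_def c_def)
  also have "\<dots> = (\<Prod>i\<in>J. if c i = 0 then q else p)"
    by (rule prob_block) (auto simp: J_def c_def)
  also have "J = {N<..n - l2} \<union> {n - l2<..n}" using True by (auto simp: J_def N_def)
  also have "(\<Prod>i\<in>\<dots>. if c i = 0 then q else p)
      = (\<Prod>i\<in>{N<..n - l2}. if c i = 0 then q else p) * (\<Prod>i\<in>{n - l2<..n}. if c i = 0 then q else p)"
    by (rule prod.union_disjoint) auto
  also have "\<dots> = q ^ j * p ^ l2" using True by (simp add: c_def N_def)
  finally show ?thesis using True by (simp add: N_def)
qed

text \<open>Expectation of \<open>power_pattern_count_rec\<close>, which holds almost surely because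
  the trials are binary almost surely.\<close>

lemma pgf_rec:
  "pgf t (Suc n) = pgf t n + (t - 1) *
     ((if l1 + l2 \<le> Suc n then q ^ l1 * p ^ l2 * pgf t (Suc n - l2 - l1) else 0)
    - (if k1 + 1 + l2 \<le> Suc n then q ^ (k1 + 1) * p ^ l2 * pgf t (Suc n - l2 - (k1 + 1)) else 0))"
proof -
  let ?e = "\<lambda>j \<omega>. t ^ H (Suc n - l2 - j) \<omega> * of_bool (run_end l2 j (Suc n) (\<lambda>i. \<zeta> i \<omega>))"
  have "AE \<omega> in M. t ^ H (Suc n) \<omega> = t ^ H n \<omega> + (t - 1) * (?e l1 \<omega> - ?e (k1 + 1) \<omega>)"
    using AE_binary
  proof (rule AE_mp, intro AE_I2 impI)
    fix \<omega> assume "\<forall>i\<ge>1. \<zeta> i \<omega> = 0 \<or> \<zeta> i \<omega> = 1"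
    thus "t ^ H (Suc n) \<omega> = t ^ H n \<omega> + (t - 1) * (?e l1 \<omega> - ?e (k1 + 1) \<omega>)"
      unfolding H_def using bounds by (intro power_pattern_count_rec) auto
  qed
  hence "pgf t (Suc n) = expectation (\<lambda>\<omega>. t ^ H n \<omega> + (t - 1) * (?e l1 \<omega> - ?e (k1 + 1) \<omega>))"
    unfolding pgf_def by (intro integral_cong_AE) measurable
  also have "\<dots> = pgf t n + (t - 1) * (expectation (?e l1) - expectation (?e (k1 + 1)))"
    unfolding pgf_def using integrable_power_H integrable_power_H_run_end by simp
  finally show ?thesis unfolding expectation_power_H_run_end .
qed

section \<open>Closed forms for the generating function and the mass function\<close>

text \<open>Both sides are 1 at 0 and obey the same recurrence: since
  \<open>k1 + 1 = l1 + m1\<close>, the two run events produce the shifts \<open>l\<close> and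
  \<open>l + m1\<close>.\<close>

lemma pgf_eq_wsum:
  defines "l \<equiv> l1 + l2" and "m1 \<equiv> k1 - l1 + 1" and "a \<equiv> q ^ l1 * p ^ l2"
  shows "pgf t n = wsum l (l + m1) (a * (t - 1)) (- (q ^ m1) * (a * (t - 1))) n"
proof (induction n rule: less_induct)
  case (less n)
  have l: "1 \<le> l" "1 \<le> l + m1" using bounds by (auto simp: l_def m1_def)
  show ?case
  proof (cases n)
    case 0
    have "H 0 \<omega> = 0" for \<omega> using bounds by (auto simp: H_def pattern_count_def zero_block_def card_eq_0_iff)
    thus ?thesis using wsum_0[OF l] 0 by (simp add: pgf_def prob_space)
  next
    case (Suc k)
    obtain L where L: "L = l + m1" by simp
    have k: "k1 + 1 + l2 = L" "Suc k - l2 - l1 = Suc k - l" "Suc k - l2 - (k1 + 1) = Suc k - L"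
      "q ^ (k1 + 1) * p ^ l2 = a * q ^ m1"
      using bounds by (auto simp: L l_def m1_def a_def simp flip: power_add)
    have "pgf t (Suc k) = pgf t k + (t - 1) * ((if l \<le> Suc k then a * pgf t (Suc k - l) else 0)
        - (if L \<le> Suc k then a * q ^ m1 * pgf t (Suc k - L) else 0))"
      using pgf_rec[of t k] unfolding k l_def[symmetric] a_def[symmetric] .
    moreover have IH: "pgf t i = wsum l L (a * (t - 1)) (- (q ^ m1) * (a * (t - 1))) i" if "i < Suc k" for i
      using less Suc that unfolding L by blast
    \<comment> \<open>As \<open>l\<close> and \<open>L\<close> are positive, all three indices are
      below \<open>Suc k\<close>, even where the subtraction truncates to 0.\<close>
    have "pgf t k = wsum l L (a * (t - 1)) (- (q ^ m1) * (a * (t - 1))) k"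
      "pgf t (Suc k - l) = wsum l L (a * (t - 1)) (- (q ^ m1) * (a * (t - 1))) (Suc k - l)"
      "pgf t (Suc k - L) = wsum l L (a * (t - 1)) (- (q ^ m1) * (a * (t - 1))) (Suc k - L)"
      by (intro IH; use l L in simp)+
    ultimately show ?thesis
      unfolding Suc L[symmetric] wsum_rec[OF l, folded L]
      by (simp only: split: if_split) (simp add: ring_distribs)
  qed
qed

lemma pgf_eq_sum:
  defines "l \<equiv> l1 + l2" and "m1 \<equiv> k1 - l1 + 1" and "a \<equiv> q ^ l1 * p ^ l2"
  shows "pgf t n = (\<Sum>u = 0..n div l. \<Sum>v = 0..(n - u * l) div (l + m1).
     multinomial (n - u * (l - 1) - v * (l + m1 - 1)) [n - u * l - v * (l + m1), u, v]
     * (-1) ^ v * q ^ (v * m1) * (a * (t - 1)) ^ (u + v))"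
proof -
  have l: "1 \<le> l" "1 \<le> l + m1" using bounds by (auto simp: l_def)
  have "(- (q ^ m1) * (a * (t - 1))) ^ v = (-1) ^ v * q ^ (v * m1) * (a * (t - 1)) ^ v" for v
    by (metis mult.commute mult_minus1 power_mult power_mult_distrib)
  thus ?thesis
    unfolding pgf_eq_wsum l_def[symmetric] m1_def[symmetric] a_def[symmetric] wsum_nested[OF l]
    by (intro sum.cong refl) (simp only: power_add mult_ac)
qed

text \<open>For every real \<open>t\<close>, two polynomials in \<open>t\<close> agree: one has the
  probabilities as coefficients, the other comes from expanding \<open>(t - 1) ^ (u + v)\<close> in
  \<open>pgf_eq_sum\<close>.\<close>

lemma prob_H_eq_sum:
  defines "l \<equiv> l1 + l2" and "m1 \<equiv> k1 - l1 + 1" and "a \<equiv> q ^ l1 * p ^ l2"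
  shows "prob {\<omega> \<in> space M. H n \<omega> = m} = (\<Sum>u = 0..n div l. \<Sum>v = 0..(n - u * l) div (l + m1).
     multinomial (n - u * (l - 1) - v * (l + m1 - 1)) [n - u * l - v * (l + m1), u, v]
     * real ((u + v) choose m) * (-1) powi (int u - int m) * q ^ (v * m1) * a ^ (u + v))"
proof -
  \<comment> \<open>Large enough to bound the count and to have the coefficient of
    \<open>t ^ m\<close> among those compared.\<close>
  define B where "B = max m ((n + 2) * (n + 2))"
  define C where "C u v = multinomial (n - u * (l - 1) - v * (l + m1 - 1)) [n - u * l - v * (l + m1), u, v]
    * q ^ (v * m1) * a ^ (u + v)" for u v
  define d where "d m = (\<Sum>u = 0..n div l. \<Sum>v = 0..(n - u * l) div (l + m1).
     C u v * real ((u + v) choose m) * (-1) powi (int u - int m))" for m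
  have l: "1 \<le> l" "1 \<le> l + m1" using bounds by (auto simp: l_def)
  have expand: "(-1) ^ v * (t - 1) ^ (u + v)
      = (\<Sum>m\<le>B. real ((u + v) choose m) * (-1) powi (int u - int m) * t ^ m)"
    if "u \<le> n div l" "v \<le> (n - u * l) div (l + m1)" for t :: real and u v
  proof -
    have "u * l \<le> n" "v * (l + m1) \<le> n - u * l"
      using that l by (auto simp: less_eq_div_iff_mult_less_eq)
    moreover have "u \<le> u * l" "v \<le> v * (l + m1)" using l by auto
    ultimately have "u + v \<le> n" by linarith
    also have "n \<le> (n + 2) * (n + 2)" by simp
    finally have uv: "u + v \<le> B" unfolding B_def by linarith
    have sgn: "(-1) ^ v * (-1) ^ (u + v - m) = ((-1) powi (int u - int m) :: real)" if "m \<le> u + v" for m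
    proof -
      have "(-1) ^ v * (-1) ^ (u + v - m) = ((-1) powi (int v + int (u + v - m)) :: real)"
        by (simp add: power_int_add)
      \<comment> \<open>The even summand \<open>2 * int v\<close> does not affect the sign. Only
        \<open>m \<le> u + v\<close> is known, so \<open>int u - int m\<close> may be negative,
        hence \<open>powi\<close>.\<close>
      also have "int v + int (u + v - m) = 2 * int v + (int u - int m)" using that by simp
      also have "((-1) powi \<dots> :: real) = (-1) powi (int u - int m)"
        by (simp add: power_int_add power_int_mult)
      finally show ?thesis .
    qed
    have "(t - 1) ^ (u + v) = (\<Sum>m\<le>u + v. real ((u + v) choose m) * t ^ m * (-1) ^ (u + v - m))"
      using binomial_ring[of t "-1" "u + v"] by simp
    hence "(-1) ^ v * (t - 1) ^ (u + v)
        = (\<Sum>m\<le>u + v. real ((u + v) choose m) * ((-1) ^ v * (-1) ^ (u + v - m)) * t ^ m)"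
      by (simp add: sum_distrib_left mult_ac)
    also have "\<dots> = (\<Sum>m\<le>u + v. real ((u + v) choose m) * (-1) powi (int u - int m) * t ^ m)"
      by (intro sum.cong refl) (simp only: sgn atMost_iff)
    \<comment> \<open>The added terms have \<open>m > u + v\<close>, where the binomial coefficient
      is 0.\<close>
    also have "\<dots> = (\<Sum>m\<le>B. real ((u + v) choose m) * (-1) powi (int u - int m) * t ^ m)"
      using uv by (intro sum.mono_neutral_left) auto
    finally show ?thesis .
  qed
  have "(\<Sum>m\<le>B. prob {\<omega> \<in> space M. H n \<omega> = m} * t ^ m) = (\<Sum>m\<le>B. d m * t ^ m)" for t
  proof -
    have "(\<Sum>m\<le>B. prob {\<omega> \<in> space M. H n \<omega> = m} * t ^ m) = pgf t n"
      unfolding pgf_def by (rule expectation_power_H[symmetric]) (simp add: B_def)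
    also have "\<dots> = (\<Sum>u = 0..n div l. \<Sum>v = 0..(n - u * l) div (l + m1).
        C u v * ((-1) ^ v * (t - 1) ^ (u + v)))"
      unfolding pgf_eq_sum l_def[symmetric] m1_def[symmetric] a_def[symmetric] C_def
      by (intro sum.cong refl) (simp only: power_mult_distrib mult_ac)
    also have "\<dots> = (\<Sum>u = 0..n div l. \<Sum>v = 0..(n - u * l) div (l + m1).
        \<Sum>m\<le>B. C u v * real ((u + v) choose m) * (-1) powi (int u - int m) * t ^ m)"
      by (intro sum.cong refl) (simp only: expand atLeastAtMost_iff sum_distrib_left mult.assoc)
    also have "\<dots> = (\<Sum>u = 0..n div l. \<Sum>m\<le>B. \<Sum>v = 0..(n - u * l) div (l + m1).
        C u v * real ((u + v) choose m) * (-1) powi (int u - int m) * t ^ m)"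
      by (intro sum.cong refl sum.swap)
    also have "\<dots> = (\<Sum>m\<le>B. d m * t ^ m)"
      unfolding d_def sum_distrib_right by (rule sum.swap)
    finally show ?thesis .
  qed
  hence "prob {\<omega> \<in> space M. H n \<omega> = m} = d m"
    using polyfun_eq_coeffs[where n = B and c = "\<lambda>m. prob {\<omega> \<in> space M. H n \<omega> = m}" and d = d] by (simp add: B_def)
  thus ?thesis unfolding d_def C_def by (simp only: mult_ac)
qed

end

end

theorem theorem2p2:
  fixes M :: "'a measure" and \<zeta> :: "nat \<Rightarrow> 'a \<Rightarrow> nat"
    and p q a :: real and l1 k1 l2 l m1 n :: nat
  assumes "prob_space M"
    and "prob_space.indep_vars M (\<lambda>_. count_space UNIV) \<zeta> {1..}"
    and "\<And>i. 1 \<le> i \<Longrightarrow> measure M {\<omega> \<in> space M. \<zeta> i \<omega> = 1} = p"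
    and "\<And>i. 1 \<le> i \<Longrightarrow> measure M {\<omega> \<in> space M. \<zeta> i \<omega> = 0} = q"
    and "0 \<le> p" and "p \<le> 1" and "q = 1 - p"
    and "1 \<le> l1" and "l1 \<le> k1" and "1 \<le> l2"
    and "a = q ^ l1 * p ^ l2" and "l = l1 + l2" and "m1 = k1 - l1 + 1"
    and "l \<le> n"
  shows "(\<forall>t::real.
            integral\<^sup>L M (\<lambda>\<omega>. t ^ pattern_count l1 k1 l2 n (\<lambda>i. \<zeta> i \<omega>)) =
            (\<Sum>u = 0..n div l. \<Sum>v = 0..(n - u * l) div (l + m1).
               multinomial (n - u * (l - 1) - v * (l + m1 - 1)) [n - u * l - v * (l + m1), u, v]
               * (-1) ^ v * q ^ (v * m1) * (a * (t - 1)) ^ (u + v)))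
       \<and> (\<forall>m::nat.
            measure M {\<omega> \<in> space M. pattern_count l1 k1 l2 n (\<lambda>i. \<zeta> i \<omega>) = m} =
            (\<Sum>u = 0..n div l. \<Sum>v = 0..(n - u * l) div (l + m1).
               multinomial (n - u * (l - 1) - v * (l + m1 - 1)) [n - u * l - v * (l + m1), u, v]
               * real ((u + v) choose m) * (-1) powi (int u - int m)
               * q ^ (v * m1) * a ^ (u + v)))"
proof -
  interpret bernoulli_trials M \<zeta> p q
    by (rule bernoulli_trials.intro, fact, unfold_locales) (use assms in auto)
  show ?thesis
    using pgf_eq_sum[OF assms(8-10)] prob_H_eq_sum[OF assms(8-10)]
    unfolding assms(11-13) pgf_def[OF assms(8-10)] H_def[OF assms(8-10)] by blast
qed

end
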